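(* Let $0<\alpha\le 1$. For every $f\in\mathcal{S}_{ex}^{\ast}$ (the class with parameter $\alpha$), the second-order inverse logarithmic Hankel determinant $H_{2,1}(F_{f^{-1}}/2)=\Gamma_1\Gamma_3-\Gamma_2^2$ satisfies \[ \left|H_{2,1}\left(F_{f^{-1}}/2\right)\right|\le \begin{cases} \dfrac{\alpha^2}{16}, & 0<\alpha\le \dfrac25,\\[8pt] \dfrac{\alpha^2(15\alpha^2+10\alpha+4)}{4(35\alpha^2+60\alpha+12)}, & \dfrac25<\alpha\le 1. \end{cases} \] The bound is sharp for all $\alpha\in(0,1]$: for each such $\alpha$ there is a function in $\mathcal{S}_{ex}^{\ast}$ for which equality holds.
   Context: Let $\mathbb{D}=\{z\in\mathbb{C}:|z|<1\}$. Let $\mathcal{A}$ be the class of analytic functions $f$ in $\mathbb{D}$ of the form $f(z)=z+\sum_{n=2}^{\infty}a_nz^n$. For analytic $F,G$ in $\mathbb{D}$, $F\prec G$ ($F$ is subordinate to $G$) means that there is an analytic $\omega:\mathbb{D}\to\mathbb{D}$ with $\omega(0)=0$ and $F(z)=G(\omega(z))$ for $z\in\mathbb{D}$. For $0<\alpha\le1$, $\mathcal{S}_{ex}^{\ast}$ is the class of all $f\in\mathcal{A}$ such that $\frac{zf'(z)}{f(z)}\prec e^{\alpha z}$ in $\mathbb{D}$ (the quotient being given the value $1$ at $z=0$); such $f$ are univalent. The inverse logarithmic coefficients $\Gamma_n$ of $f$ are defined by the expansion, near $w=0$, $F_{f^{-1}}(w)=\log\frac{f^{-1}(w)}{w}=2\sum_{n=1}^{\infty}\Gamma_nw^n$,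 where $f^{-1}$ is the local inverse of $f$ at $0$ and the logarithm vanishes at $w=0$. Equivalently, $\Gamma_1=-\frac12a_2$, $\Gamma_2=-\frac12a_3+\frac34a_2^2$, $\Gamma_3=-\frac12\left(a_4-4a_2a_3+\frac{10}{3}a_2^3\right)$. The second-order inverse logarithmic Hankel determinant is $H_{2,1}(F_{f^{-1}}/2)=\begin{vmatrix}\Gamma_1&\Gamma_2\\ \Gamma_2&\Gamma_3\end{vmatrix}$. *)

theory Defs
  imports "HOL-Complex_Analysis.Complex_Analysis"
begin

abbreviation unit_disc :: "complex set" where
  "unit_disc \<equiv> ball 0 1"

definition class_A :: "(complex \<Rightarrow> complex) set" where
  "class_A = {f. f holomorphic_on unit_disc \<and> f 0 = 0 \<and> deriv f 0 = 1}"

definition subordinate :: "(complex \<Rightarrow> complex) \<Rightarrow> (complex \<Rightarrow> complex) \<Rightarrow> bool" where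
  "subordinate F G \<longleftrightarrow>
     F holomorphic_on unit_disc \<and> G holomorphic_on unit_disc \<and>
     (\<exists>\<omega>. \<omega> holomorphic_on unit_disc \<and> \<omega> ` unit_disc \<subseteq> unit_disc \<and> \<omega> 0 = 0 \<and>
          (\<forall>z\<in>unit_disc. F z = G (\<omega> z)))"

(* Division by zero causes no harm: a zero of f in the punctured disc would give the
   quotient the value 0, which the exponential omits. *)
definition starlike_exp :: "real \<Rightarrow> (complex \<Rightarrow> complex) set" where
  "starlike_exp \<alpha> =
     {f \<in> class_A. subordinate (\<lambda>z. if z = 0 then 1 else z * deriv f z / f z)
                               (\<lambda>z. exp (of_real \<alpha> * z))}"

definition is_local_inverse :: "(complex \<Rightarrow> complex) \<Rightarrow> (complex \<Rightarrow> complex) \<Rightarrow> bool" where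
  "is_local_inverse f g \<longleftrightarrow>
     (\<exists>r>0. g holomorphic_on ball 0 r \<and> g ` ball 0 r \<subseteq> unit_disc \<and> g 0 = 0 \<and>
            (\<forall>w\<in>ball 0 r. f (g w) = w))"

lemma local_inverse_exists:
  assumes "f \<in> class_A"
  shows "\<exists>g. is_local_inverse f g"
proof -
  have hol: "f holomorphic_on unit_disc" and f0: "f 0 = 0" and d: "deriv f 0 \<noteq> 0"
    using assms by (auto simp: class_A_def)
  obtain r where r: "r > 0" "ball 0 r \<subseteq> unit_disc" "inj_on f (ball 0 r)"
    using has_complex_derivative_locally_injective[OF hol _ _ d] by auto
  have holr: "f holomorphic_on ball 0 r"
    using hol r(2) by (rule holomorphic_on_subset)
  obtain g where g: "g holomorphic_on (f ` ball 0 r)" "\<And>z. z \<in> ball 0 r \<Longrightarrow> g (f z) = z"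
    using holomorphic_has_inverse[OF holr _ r(3)] by (metis open_ball)
  have "open (f ` ball 0 r)"
    using open_mapping_thm3[OF holr _ r(3)] by simp
  moreover have "0 \<in> f ` ball 0 r"
    using f0 r(1) by (metis centre_in_ball imageI)
  ultimately obtain s where s: "s > 0" "ball 0 s \<subseteq> f ` ball 0 r"
    by (meson open_contains_ball)
  have "g holomorphic_on ball 0 s"
    using g(1) s(2) by (rule holomorphic_on_subset)
  moreover have "g ` ball 0 s \<subseteq> unit_disc" "\<forall>w\<in>ball 0 s. f (g w) = w"
    using s(2) g(2) r(2) by fastforce+
  moreover have "g 0 = 0"
    using g(2)[of 0] f0 r(1) by simp
  ultimately show ?thesis
    using s(1) unfolding is_local_inverse_def by blast
qed

(* The local inverse is unique only as a germ at 0; the coefficients below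
   depend only on that germ. *)
definition local_inverse :: "(complex \<Rightarrow> complex) \<Rightarrow> complex \<Rightarrow> complex" where
  "local_inverse f = (SOME g. is_local_inverse f g)"

(* The value 1 at 0 is the limit of the quotient there; the principal logarithm is the
   branch that vanishes at 0. *)
definition inverse_log :: "(complex \<Rightarrow> complex) \<Rightarrow> complex \<Rightarrow> complex" where
  "inverse_log f w = Ln (if w = 0 then 1 else local_inverse f w / w)"

definition inverse_log_coeff :: "(complex \<Rightarrow> complex) \<Rightarrow> nat \<Rightarrow> complex" where
  "inverse_log_coeff f n = fps_nth (fps_expansion (inverse_log f) 0) n / 2"

definition inverse_log_hankel :: "(complex \<Rightarrow> complex) \<Rightarrow> complex" where
  "inverse_log_hankel f =
     det (vector [vector [inverse_log_coeff f 1, inverse_log_coeff f 2],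
                  vector [inverse_log_coeff f 2, inverse_log_coeff f 3]] :: complex ^ 2 ^ 2)"

end

theory Submission
  imports Defs
begin

text \<open>
  Write $z f'(z) / f(z) = \exp (\alpha\omega(z))$ with a Schwarz function
  $\omega(z) = w_1 z + w_2 z^2 + w_3 z^3 + \dots$.  Comparing coefficients expresses
  $a_2, a_3, a_4$, and hence the inverse logarithmic coefficients, through the $w_i$; everything
  collapses to
  \[ \Gamma_1\Gamma_3 - \Gamma_2^2 = \frac{\alpha^2}{576}
     \bigl(48 w_1 w_3 - 36 w_2^2 - 60 \alpha w_1^2 w_2 + 35 \alpha^2 w_1^4\bigr) \]
  (\<open>inverse_log_hankel_starlike\<close>).  Two steps of the Schur algorithm parametrise the
  coefficients by three points $c, x, y$ of the closed disc (\<open>schur_parameters\<close>):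
  $w_1 = c$, $w_2 = (1 - |c|^2) x$, $w_3 = (1 - |c|^2) ((1 - |x|^2) y - \bar c x^2)$.

  Put $s = |c|^2$.  After a rotation of $x$ to a point $X$, the bracket is bounded by
  \[ |A - B X - C X^2| + D (1 - |X|^2), \qquad A = 35\alpha^2 s^2,\quad B = 60 \alpha s (1 - s),\quad
     C = 12 (1 - s)(3 + s),\quad D = 48 \sqrt s\, (1 - s) . \]
  On a circle $|X| = r$ the square of the first modulus is a concave quadratic polynomial in the real
  part of $X$.  Its vertex gives the bound
  $(A + C r^2) \sqrt{1 + B^2 / (4 A C)}$
  (\<open>cmod_quadratic_le_square_case\<close>).  If $B (C - A) \ge 4 A C$, then for $r = 1$ the vertex
  lies at or beyond the right end of the circle, the maximum is attained at $X = 1$, and the modulus is at most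
  $B - A + C r^2$ for all $r \le 1$ (\<open>cmod_quadratic_le_linear_case\<close>).  As $D \le C$,
  the resulting bound for the total is in both cases largest at $r = 1$.

  If $B (C - A) \ge 4 A C$, that bound is $B + C - A$, which is a concave quadratic in $s$; its
  maximum over $s \ge 0$ is exactly $576 / \alpha^2$ times the asserted bound, attained at $s = 0$ for
  $\alpha \le 2/5$ and at an inner point otherwise.  In the remaining case $s$ is
  bounded away from $0$, and the vertex bound stays below that maximum by a margin that crude
  monotonicity estimates can afford (\<open>square_case_estimate\<close>).  Equality holds for the function
  $\omega(z) = z (z + c) / (1 + c z)$ with $c^2$ the maximising $s$.
\<close>

section \<open>Moduli of quadratic polynomials on the disc\<close>

lemma cmod_quadratic_squared:
  fixes A B C :: real and X :: complex
  shows "(cmod (A - B * X - C * X\<^sup>2))\<^sup>2 =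
    (A + C * (cmod X)\<^sup>2)\<^sup>2 + B\<^sup>2 * (cmod X)\<^sup>2 - 4 * A * C * (Re X)\<^sup>2
      + 2 * (C * (cmod X)\<^sup>2 - A) * B * Re X"
  unfolding cmod_power2 by (simp add: power2_eq_square) algebra

text \<open>
  With \<open>q = |X|\<^sup>2\<close> and \<open>v = Re X\<close>, the difference of the squares of the two sides is affine in \<open>q\<close> on
  the interval from \<open>v\<^sup>2\<close> to \<open>1\<close>, so it suffices to look at the two end points; at \<open>q = 1\<close> the
  hypothesis enters, at \<open>q = v\<^sup>2\<close> its consequences \<open>A \<le> C\<close> and \<open>4 A \<le> B\<close>.
\<close>
lemma cmod_quadratic_le_linear_case:
  fixes A B C :: real and X :: complex
  assumes A: "0 \<le> A" and B: "0 \<le> B" and C: "0 < C"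
    and AC: "4 * A * C \<le> B * (C - A)" and X: "cmod X \<le> 1"
  shows "cmod (A - B * X - C * X\<^sup>2) \<le> B - A + C * (cmod X)\<^sup>2"
proof -
  define q v where "q = (cmod X)\<^sup>2" and "v = Re X"
  have v2: "v\<^sup>2 \<le> q" 
    unfolding q_def v_def by (simp add: cmod_power2)
  have q1: "q \<le> 1" using X by (simp add: q_def abs_square_le_1)
  have v: "v \<le> 1" "-1 \<le> v"
    using abs_Re_le_cmod[of X] X by (auto simp: v_def)
  have CA: "A \<le> C"
  proof (rule ccontr)
    assume "\<not> A \<le> C"
    then have "B * (C - A) \<le> 0" "0 < 4 * A * C"
      using B C by (auto intro: mult_nonneg_nonpos)
    then show False using AC by linarith
  qed
  have BA: "4 * A \<le> B"
  proof -
    have "4 * A * C \<le> B * C"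
      using AC mult_nonneg_nonneg[OF B A] by (simp add: algebra_simps)
    then show ?thesis using C by simp
  qed
  define D where "D p = B\<^sup>2 * (1 - p) - 4*A*C*(p - v\<^sup>2) + 2*B*(C*p - A)*(1 - v)" for p
  have D1: "0 \<le> D 1"
  proof -
    have "2*A*C*(1+v) \<le> 4*A*C"
    proof -
      have "2*A*C*(1+v) \<le> 2*A*C*2" by (rule mult_left_mono) (use A C v in auto)
      then show ?thesis by simp
    qed
    then have "0 \<le> 2 * (1 - v) * (B * (C - A) - 2*A*C*(1+v))"
      using AC v by (intro mult_nonneg_nonneg) auto
    also have "\<dots> = D 1" by (simp add: D_def algebra_simps power2_eq_square)
    finally show ?thesis .
  qed
  have Dv: "0 \<le> D (v\<^sup>2)"
  proof -
    have "4*A*(1+v) \<le> B*(1+v)" using BA v by (intro mult_right_mono) auto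
    moreover have "A* v\<^sup>2 \<le> C* v\<^sup>2" using CA by (intro mult_right_mono) auto
    moreover have "0 \<le> 2*A*(1+v)\<^sup>2" using A by simp
    ultimately have "0 \<le> B*(1+v) + 2*C* v\<^sup>2 - 2*A"
      by (simp add: algebra_simps power2_eq_square)
    then have "0 \<le> (1 - v) * B * (B*(1+v) + 2*C* v\<^sup>2 - 2*A)"
      using B v by simp
    also have "\<dots> = D (v\<^sup>2)" by (simp add: D_def algebra_simps power2_eq_square)
    finally show ?thesis .
  qed
  have "0 \<le> D q"
  proof (cases "v\<^sup>2 = 1")
    case True then have "q = 1" using v2 q1 by simp
    then show ?thesis using D1 by simp
  next
    case False
    then have pos: "0 < 1 - v\<^sup>2" using v2 q1 by simp
    have "(1 - v\<^sup>2) * D q = (q - v\<^sup>2) * D 1 + (1 - q) * D (v\<^sup>2)"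
      by (simp add: D_def algebra_simps power2_eq_square)
    also have "\<dots> \<ge> 0" using D1 Dv v2 q1 by simp
    finally show ?thesis using pos by (simp add: zero_le_mult_iff)
  qed
  also have "D q = (B - A + C * q)\<^sup>2 - (cmod (A - B * X - C * X\<^sup>2))\<^sup>2"
    unfolding cmod_quadratic_squared q_def[symmetric] v_def[symmetric] D_def
    by (simp add: algebra_simps power2_eq_square)
  finally have "(cmod (A - B * X - C * X\<^sup>2))\<^sup>2 \<le> (B - A + C * q)\<^sup>2" by simp
  moreover have "0 \<le> B - A + C * q" using BA A C by (simp add: q_def)
  ultimately show ?thesis unfolding q_def by (rule power2_le_imp_le)
qed

text \<open>
  For fixed \<open>|X|\<close> the squared modulus is a concave quadratic polynomial in \<open>Re X\<close>.  Completing the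
  square gives \<open>(A + C |X|\<^sup>2)\<^sup>2 (1 + B\<^sup>2 / (4 A C))\<close> as its value at the vertex, and the hypothesis on
  \<open>k\<close> says that the last factor is at most \<open>k\<^sup>2\<close>.
\<close>
lemma cmod_quadratic_le_square_case:
  fixes A B C k :: real and X :: complex
  assumes A: "0 < A" and C: "0 < C" and k: "0 \<le> k" "4 * A * C + B\<^sup>2 \<le> 4 * A * C * k\<^sup>2"
  shows "cmod (A - B * X - C * X\<^sup>2) \<le> k * (A + C * (cmod X)\<^sup>2)"
proof -
  define q v where "q = (cmod X)\<^sup>2" and "v = Re X"
  have q: "0 \<le> q" by (simp add: q_def)
  have "4*A*C * (cmod (A - B * X - C * X\<^sup>2))\<^sup>2 =
      (4*A*C + B\<^sup>2) * (A + C * q)\<^sup>2 - (B * (C * q - A) - 4*A*C* v)\<^sup>2"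
    unfolding cmod_quadratic_squared q_def[symmetric] v_def[symmetric]
    by algebra
  also have "\<dots> \<le> (4*A*C + B\<^sup>2) * (A + C * q)\<^sup>2" by simp
  also have "\<dots> \<le> (4*A*C*k\<^sup>2) * (A + C * q)\<^sup>2" using k(2) by (rule mult_right_mono) simp
  also have "\<dots> = 4*A*C * (k * (A + C * q))\<^sup>2" by (simp add: power_mult_distrib)
  finally have "(cmod (A - B * X - C * X\<^sup>2))\<^sup>2 \<le> (k * (A + C * q))\<^sup>2"
    using A C by simp
  then show ?thesis unfolding q_def
    by (rule power2_le_imp_le) (use A C k in simp)
qed

section \<open>The extremal problem for the Schur parameters\<close>

text \<open>
  The bound of the theorem multiplied by \<open>576 / \<alpha>\<^sup>2\<close>, in the form in which it arises: as the maximum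
  of \<open>36 + (60 \<alpha> - 24) s - (12 + 60 \<alpha> + 35 \<alpha>\<^sup>2) s\<^sup>2\<close> over \<open>s \<ge> 0\<close>.
\<close>
definition scaled_bound :: "real \<Rightarrow> real" where
  "scaled_bound \<alpha> = (if \<alpha> \<le> 2 / 5 then 36
     else 36 + (30 * \<alpha> - 12)\<^sup>2 / (12 + 60 * \<alpha> + 35 * \<alpha>\<^sup>2))"

lemma scaled_bound_ge: assumes "0 < \<alpha>" shows "36 \<le> scaled_bound \<alpha>"
  using assms by (simp add: scaled_bound_def)

lemma parabola_le_scaled_bound:
  fixes \<alpha> s :: real
  assumes a: "0 < \<alpha>" and s: "0 \<le> s"
  shows "36 + (60 * \<alpha> - 24) * s - (12 + 60 * \<alpha> + 35 * \<alpha>\<^sup>2) * s\<^sup>2 \<le> scaled_bound \<alpha>"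
proof (cases "\<alpha> \<le> 2/5")
  case True
  then have "(60 * \<alpha> - 24) * s \<le> 0" using s by (simp add: mult_nonpos_nonneg)
  moreover have "0 \<le> (12 + 60 * \<alpha> + 35 * \<alpha>\<^sup>2) * s\<^sup>2" using a by simp
  ultimately show ?thesis using True by (simp add: scaled_bound_def)
next
  case False
  define d where "d = 12 + 60 * \<alpha> + 35 * \<alpha>\<^sup>2"
  have d: "0 < d" using a unfolding d_def by (intro add_pos_nonneg) auto
  have "0 \<le> (30 * \<alpha> - 12 - d * s)\<^sup>2 / d" using d by simp
  also have "\<dots> = (30 * \<alpha> - 12)\<^sup>2 / d - (60 * \<alpha> - 24) * s + d * s\<^sup>2"
    using d by (simp add: field_simps power2_eq_square)
  finally show ?thesis using False by (simp add: scaled_bound_def d_def)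
qed

text \<open>
  For \<open>\<alpha>\<close> near \<open>1\<close> the value \<open>36\<close> is too small for the vertex bound below; \<open>17/20\<close> is a threshold from which
  the gain of \<open>2\<close> is available.
\<close>
lemma scaled_bound_ge_38:
  assumes "17/20 \<le> \<alpha>" shows "38 \<le> scaled_bound \<alpha>"
proof -
  have d: "0 < 12 + 60 * \<alpha> + 35 * \<alpha>\<^sup>2" using assms by (intro add_pos_nonneg) auto
  have "0 \<le> (\<alpha> - 17/20) * (830 * \<alpha> - 269/2)" using assms by simp
  then have "2 * (12 + 60 * \<alpha> + 35 * \<alpha>\<^sup>2) \<le> (30 * \<alpha> - 12)\<^sup>2"
    using assms by (simp add: algebra_simps power2_eq_square)
  then have "2 \<le> (30 * \<alpha> - 12)\<^sup>2 / (12 + 60 * \<alpha> + 35 * \<alpha>\<^sup>2)"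
    using d by (simp add: pos_le_divide_eq)
  then show ?thesis using assms by (simp add: scaled_bound_def)
qed

text \<open>
  The sum \<open>A + C\<close> is \<open>36 - 24 s + (35 \<alpha>\<^sup>2 - 12) s\<^sup>2\<close>.  Its last coefficient can be negative, but replaced by a
  non-negative upper bound \<open>m\<close> it gives a convex function, which end point values control.
\<close>
lemma convex_quadratic_le:
  fixes a b s m :: real
  assumes "0 \<le> m" "a \<le> s" "s \<le> b" "36 - 24 * a + m * a\<^sup>2 \<le> M" "36 - 24 * b + m * b\<^sup>2 \<le> M"
  shows "36 - 24 * s + m * s\<^sup>2 \<le> M"
proof (cases "a = b")
  case True then show ?thesis using assms by simp
next
  case False
  then have ab: "0 < b - a" using assms by simp
  have "(b - a) * (36 - 24 * s + m * s\<^sup>2) = (b - s) * (36 - 24 * a + m * a\<^sup>2)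
     + (s - a) * (36 - 24 * b + m * b\<^sup>2) - m * (b - a) * (b - s) * (s - a)"
    by algebra
  also have "\<dots> \<le> (b - s) * M + (s - a) * M - 0"
    by (intro diff_mono add_mono mult_left_mono mult_nonneg_nonneg) (use assms in auto)
  also have "\<dots> = (b - a) * M" by (simp add: algebra_simps)
  finally show ?thesis using ab by simp
qed

text \<open>
  The last hypothesis says \<open>B (C - A) < 4 A C\<close>.  It becomes weaker as \<open>\<alpha>\<close> grows, so that the case
  \<open>\<alpha> = t\<close> of an upper end \<open>t\<close> of an \<open>\<alpha>\<close>-range yields a lower bound for \<open>s\<close> on the whole range.  Here
  \<open>1 + B\<^sup>2 / (4 A C) = (36 - 8 s) / (7 (3 + s))\<close> decreases in \<open>s\<close> and \<open>A + C\<close> is at most a convex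
  quadratic in \<open>s\<close>; on each of a few intervals the product of the two separate maxima is small enough.
\<close>
lemma square_case_estimate:
  fixes \<alpha> s :: real
  assumes a: "0 < \<alpha>" "\<alpha> \<le> 1" and s: "0 \<le> s" "s < 1"
    and case2: "0 < 4 * (35 * \<alpha>\<^sup>2 * s\<^sup>2) * (12 * (1 - s) * (3 + s))
         - (60 * \<alpha> * s * (1 - s)) * (12 * (1 - s) * (3 + s) - 35 * \<alpha>\<^sup>2 * s\<^sup>2)"
  obtains k where "1 \<le> k" "36 - 8 * s \<le> 7 * (3 + s) * k\<^sup>2"
    "k * (36 - 24 * s + (35 * \<alpha>\<^sup>2 - 12) * s\<^sup>2) \<le> scaled_bound \<alpha>"
proof -
  have "s \<noteq> 0" using case2 by auto
  then have s0: "0 < s" using s by simp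
  \<comment> \<open>the hypothesis divided by the common factor \<open>20 \<alpha> s (1 - s)\<close>\<close>
  have reg: "0 < 84 * \<alpha> * s * (3 + s) + 105 * \<alpha>\<^sup>2 * s\<^sup>2 - 36 * (1 - s) * (3 + s)"
  proof -
    have "4 * (35 * \<alpha>\<^sup>2 * s\<^sup>2) * (12 * (1 - s) * (3 + s))
         - (60 * \<alpha> * s * (1 - s)) * (12 * (1 - s) * (3 + s) - 35 * \<alpha>\<^sup>2 * s\<^sup>2)
       = (20 * \<alpha> * s * (1 - s)) * (84 * \<alpha> * s * (3 + s) + 105 * \<alpha>\<^sup>2 * s\<^sup>2 - 36 * (1 - s) * (3 + s))"
      by algebra
    moreover have "0 < 20 * \<alpha> * s * (1 - s)" using a s s0 by simp
    ultimately show ?thesis using case2 zero_less_mult_pos by metis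
  qed
  have reg_mono: "0 < 84 * t * s * (3 + s) + 105 * t\<^sup>2 * s\<^sup>2 - 36 * (1 - s) * (3 + s)"
    if "\<alpha> \<le> t" for t
  proof -
    have "84 * \<alpha> * s * (3 + s) \<le> 84 * t * s * (3 + s)"
      using that s by (intro mult_right_mono) auto
    moreover have "105 * \<alpha>\<^sup>2 * s\<^sup>2 \<le> 105 * t\<^sup>2 * s\<^sup>2"
      using that a by (intro mult_right_mono mult_left_mono power_mono) auto
    ultimately show ?thesis using reg by linarith
  qed
  have sum_mono: "36 - 24 * s + (35 * \<alpha>\<^sup>2 - 12) * s\<^sup>2 \<le> 36 - 24 * s + m * s\<^sup>2"
    if "\<alpha> \<le> t" "35 * t\<^sup>2 - 12 \<le> m" for t m
  proof -
    have "\<alpha>\<^sup>2 \<le> t\<^sup>2" using that a by (intro power_mono) auto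
    then show ?thesis using that(2) by (intro add_left_mono mult_right_mono) auto
  qed
  \<comment> \<open>Below, \<open>l\<close> is the left end of an interval for \<open>s\<close>, \<open>k\<close> a number slightly above the square root of
      \<open>(36 - 8 l) / (7 (3 + l))\<close>, and \<open>M\<close> a bound for \<open>A + C\<close> on the interval.\<close>
  have finish: thesis if "l \<le> s" "1 \<le> k" "36 - 8 * l \<le> 7 * (3 + l) * k\<^sup>2"
    "36 - 24 * s + (35 * \<alpha>\<^sup>2 - 12) * s\<^sup>2 \<le> M" "k * M \<le> scaled_bound \<alpha>" for l k M
  proof (rule \<open>\<And>k. _ \<Longrightarrow> _ \<Longrightarrow> _ \<Longrightarrow> thesis\<close>)
    have "7 * (3 + l) * k\<^sup>2 \<le> 7 * (3 + s) * k\<^sup>2" using that(1) by (intro mult_right_mono) auto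
    then show "36 - 8 * s \<le> 7 * (3 + s) * k\<^sup>2" using that by linarith
    have "k * (36 - 24 * s + (35 * \<alpha>\<^sup>2 - 12) * s\<^sup>2) \<le> k * M"
      using that by (intro mult_left_mono) auto
    then show "k * (36 - 24 * s + (35 * \<alpha>\<^sup>2 - 12) * s\<^sup>2) \<le> scaled_bound \<alpha>"
      using that by linarith
  qed fact
  show thesis
  proof (cases "\<alpha> \<le> 17/20")
    case True
    \<comment> \<open>the positive root of the quadratic for \<open>t = 17/20\<close> is about \<open>0.314\<close>\<close>
    have lower: "31/100 \<le> s"
    proof (rule ccontr)
      assume n: "\<not> 31/100 \<le> s"
      then have "s * s \<le> 31/100 * (31/100)" using s by (intro mult_mono) auto
      moreover have "0 < 14661/80 * (s * s) + 1431/5 * s - 108"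
        using reg_mono[OF True] by (simp add: power2_eq_square field_simps)
      ultimately show False using n by linarith
    qed
    have "36 - 24 * s + (35 * \<alpha>\<^sup>2 - 12) * s\<^sup>2 \<le> 36 - 24 * s + (133/10) * s\<^sup>2"
      by (rule sum_mono[OF True]) (simp add: power2_eq_square)
    also have "\<dots> \<le> 2985/100"
      by (rule convex_quadratic_le[of _ "31/100" _ 1]) (use lower s in \<open>auto simp: power2_eq_square\<close>)
    finally show thesis
      using scaled_bound_ge[OF a(1)] lower
      by (intro finish[of "31/100" "1203/1000" "2985/100"]) (auto simp: power2_eq_square)
  next
    case False
    then have K: "38 \<le> scaled_bound \<alpha>" by (intro scaled_bound_ge_38) auto
    \<comment> \<open>the positive root of the quadratic for \<open>t = 1\<close> is about \<open>0.2792\<close>\<close>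
    have lower: "279/1000 \<le> s"
    proof (rule ccontr)
      assume n: "\<not> 279/1000 \<le> s"
      then have "s * s \<le> 279/1000 * (279/1000)" using s by (intro mult_mono) auto
      then show False using n reg_mono[OF a(2)] s by (simp add: power2_eq_square algebra_simps)
    qed
    have up: "36 - 24 * s + (35 * \<alpha>\<^sup>2 - 12) * s\<^sup>2 \<le> 36 - 24 * s + 23 * s\<^sup>2"
      by (rule sum_mono[OF a(2)]) simp
    consider "s \<le> 6/10" | "6/10 \<le> s" "s \<le> 85/100" | "85/100 \<le> s" by linarith
    then show thesis
    proof cases
      case 1
      have "36 - 24 * s + 23 * s\<^sup>2 \<le> 311/10"
        by (rule convex_quadratic_le[of _ "279/1000" _ "6/10"]) (use 1 lower in \<open>auto simp: power2_eq_square\<close>)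
      from order_trans[OF up this] show thesis using K lower
        by (intro finish[of "279/1000" "1214/1000" "311/10"]) (auto simp: power2_eq_square)
    next
      case 2
      have "36 - 24 * s + 23 * s\<^sup>2 \<le> 323/10"
        by (rule convex_quadratic_le[of _ "6/10" _ "85/100"]) (use 2 in \<open>auto simp: power2_eq_square\<close>)
      from order_trans[OF up this] show thesis using K 2
        by (intro finish[of "6/10" "112/100" "323/10"]) (auto simp: power2_eq_square)
    next
      case 3
      have "36 - 24 * s + 23 * s\<^sup>2 \<le> 35"
        by (rule convex_quadratic_le[of _ "85/100" _ 1]) (use 3 s in \<open>auto simp: power2_eq_square\<close>)
      from order_trans[OF up this] show thesis using K 3
        by (intro finish[of "85/100" "105/100" "35"]) (auto simp: power2_eq_square)
    qed
  qed
qed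

text \<open>
  The weight of the second summand is at most \<open>C = 12 (1 - s) (3 + s)\<close>, the difference being
  \<open>12 (1 - s) (1 - t) (3 - t)\<close>.  Hence in either bound for the modulus the gain from increasing \<open>|X|\<close>
  to \<open>1\<close> outweighs the loss in that summand.
\<close>
lemma real_parameter_estimate:
  fixes \<alpha> t :: real and X :: complex
  defines "s \<equiv> t\<^sup>2"
  assumes a: "0 < \<alpha>" "\<alpha> \<le> 1" and t: "0 \<le> t" "t \<le> 1" and X: "cmod X \<le> 1"
  shows "cmod (of_real (35 * \<alpha>\<^sup>2 * s\<^sup>2) - of_real (60 * \<alpha> * s * (1 - s)) * X
                 - of_real (12 * (1 - s) * (3 + s)) * X\<^sup>2)
          + 48 * t * (1 - s) * (1 - (cmod X)\<^sup>2) \<le> scaled_bound \<alpha>"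
proof (cases "t = 1")
  case True
  \<comment> \<open>here \<open>s = 1\<close>, and only the constant \<open>35 \<alpha>\<^sup>2\<close> remains\<close>
  have "35 * \<alpha>\<^sup>2 \<le> 35 * 1" using a by (intro mult_left_mono) (auto simp: power_le_one)
  then have "35 * \<alpha>\<^sup>2 \<le> scaled_bound \<alpha>" using scaled_bound_ge[OF a(1)] by linarith
  then show ?thesis using True by (simp add: s_def norm_mult norm_power)
next
  case False
  have s: "0 \<le> s" "s < 1"
    using t False by (auto simp: s_def power2_eq_square) (smt (verit) mult_left_le)
  define A B C D q where "A = 35 * \<alpha>\<^sup>2 * s\<^sup>2" and "B = 60 * \<alpha> * s * (1 - s)"
    and "C = 12 * (1 - s) * (3 + s)" and "D = 48 * t * (1 - s)" and "q = (cmod X)\<^sup>2"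
  have A: "0 \<le> A" and B: "0 \<le> B" and C: "0 < C" using a s by (auto simp: A_def B_def C_def)
  have q: "0 \<le> q" "q \<le> 1" using X by (auto simp: q_def abs_square_le_1)
  have DC: "D \<le> C"
  proof -
    have "0 \<le> 12 * (1 - s) * ((1 - t) * (3 - t))" using s t by simp
    then show ?thesis by (simp add: C_def D_def s_def algebra_simps power2_eq_square)
  qed
  have "cmod (A - B * X - C * X\<^sup>2) + D * (1 - q) \<le> scaled_bound \<alpha>"
  proof (cases "4 * A * C \<le> B * (C - A)")
    case True
    have "cmod (A - B * X - C * X\<^sup>2) \<le> B - A + C * q"
      unfolding q_def by (rule cmod_quadratic_le_linear_case[OF A B C True X])
    moreover have "D * (1 - q) \<le> C * (1 - q)" using DC q by (intro mult_right_mono) auto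
    ultimately have "cmod (A - B * X - C * X\<^sup>2) + D * (1 - q) \<le> B + C - A"
      by (simp add: algebra_simps)
    also have "\<dots> = 36 + (60 * \<alpha> - 24) * s - (12 + 60 * \<alpha> + 35 * \<alpha>\<^sup>2) * s\<^sup>2"
      by (simp add: A_def B_def C_def algebra_simps power2_eq_square)
    also have "\<dots> \<le> scaled_bound \<alpha>" using a s by (intro parabola_le_scaled_bound) auto
    finally show ?thesis .
  next
    case False
    then have pos: "0 < 4 * A * C - B * (C - A)" by simp
    then have s0: "s \<noteq> 0" by (auto simp: A_def B_def)
    have A0: "0 < A" using a s s0 by (simp add: A_def)
    obtain k where k: "1 \<le> k" "36 - 8 * s \<le> 7 * (3 + s) * k\<^sup>2"
      "k * (36 - 24 * s + (35 * \<alpha>\<^sup>2 - 12) * s\<^sup>2) \<le> scaled_bound \<alpha>"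
      using square_case_estimate[OF a s pos[unfolded A_def B_def C_def]] by metis
    have kAC: "4 * A * C + B\<^sup>2 \<le> 4 * A * C * k\<^sup>2"
    proof -
      have "4 * A * C + B\<^sup>2 = (240 * \<alpha>\<^sup>2 * s\<^sup>2 * (1 - s)) * (36 - 8 * s)"
        by (simp add: A_def B_def C_def) algebra
      also have "\<dots> \<le> (240 * \<alpha>\<^sup>2 * s\<^sup>2 * (1 - s)) * (7 * (3 + s) * k\<^sup>2)"
        using k(2) s by (intro mult_left_mono) auto
      also have "\<dots> = 4 * A * C * k\<^sup>2" by (simp add: A_def C_def algebra_simps)
      finally show ?thesis .
    qed
    have "cmod (A - B * X - C * X\<^sup>2) \<le> k * (A + C * q)"
      unfolding q_def using k kAC by (intro cmod_quadratic_le_square_case[OF A0 C]) auto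
    moreover have "D * (1 - q) \<le> C * (1 - q)" using DC q by (intro mult_right_mono) auto
    moreover have "1 * (C * (1 - q)) \<le> k * (C * (1 - q))"
      using k C q by (intro mult_right_mono) auto
    ultimately have "cmod (A - B * X - C * X\<^sup>2) + D * (1 - q) \<le> k * (A + C)"
      by (simp add: algebra_simps)
    also have "A + C = 36 - 24 * s + (35 * \<alpha>\<^sup>2 - 12) * s\<^sup>2"
      by (simp add: A_def C_def algebra_simps power2_eq_square)
    finally show ?thesis using k(3) by linarith
  qed
  then show ?thesis by (simp add: A_def B_def C_def D_def q_def)
qed

text \<open>
  Writing \<open>c\<^sup>2 = s e\<close> and \<open>x = e X\<close> with \<open>|e| = 1\<close> makes all terms except the one with \<open>y\<close> a common
  multiple \<open>e\<^sup>2\<close> of a quadratic polynomial in \<open>X\<close> with real coefficients; \<open>y\<close> enters only through the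
  triangle inequality.
\<close>
lemma schur_parameter_estimate:
  fixes \<alpha> :: real and c x y :: complex
  defines "w2 \<equiv> (1 - c * cnj c) * x"
  defines "w3 \<equiv> (1 - c * cnj c) * ((1 - x * cnj x) * y - cnj c * x\<^sup>2)"
  assumes a: "0 < \<alpha>" "\<alpha> \<le> 1" and c: "cmod c \<le> 1" and x: "cmod x \<le> 1" and y: "cmod y \<le> 1"
  shows "cmod (48 * c * w3 - 36 * w2\<^sup>2 - 60 * of_real \<alpha> * c\<^sup>2 * w2 + 35 * (of_real \<alpha>)\<^sup>2 * c ^ 4) \<le> scaled_bound \<alpha>"
proof -
  define t s where "t = cmod c" and "s = t\<^sup>2"
  define e where "e = (if c = 0 then 1 else c\<^sup>2 / of_real s)"
  have cc: "c * cnj c = of_real s" by (simp only: complex_norm_square s_def t_def)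
  have ce: "c\<^sup>2 = of_real s * e" by (auto simp: e_def s_def t_def)
  have e1: "cmod e = 1" by (auto simp: e_def s_def t_def norm_divide norm_power)
  then have ee: "e * cnj e = 1" by (simp add: complex_norm_square[symmetric])
  define X where "X = cnj e * x"
  have xX: "x = e * X" using ee by (simp add: X_def mult.assoc[symmetric])
  have Xx: "cmod X = cmod x" by (simp add: X_def norm_mult e1)
  have t1: "0 \<le> t" "t \<le> 1" using c by (auto simp: t_def)
  have s1: "0 \<le> s" "s \<le> 1" using t1 by (auto simp: s_def power_le_one)
  have xx: "x * cnj x = of_real ((cmod X)\<^sup>2)" by (simp only: complex_norm_square Xx)
  define Z where "Z = of_real (35 * \<alpha>\<^sup>2 * s\<^sup>2) - of_real (60 * \<alpha> * s * (1 - s)) * X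
                 - of_real (12 * (1 - s) * (3 + s)) * X\<^sup>2"
  define R where "R = of_real (48 * (1 - s) * (1 - (cmod X)\<^sup>2)) * (c * y)"
  have "48 * c * w3 = 48 * (1 - c * cnj c) * (1 - x * cnj x) * (c * y)
      - 48 * (1 - c * cnj c) * (c * cnj c) * x\<^sup>2"
    unfolding w3_def by (simp add: algebra_simps)
  also have "\<dots> = R - 48 * (1 - of_real s) * of_real s * x\<^sup>2"
    unfolding R_def cc xx by simp
  finally have "48 * c * w3 - 36 * w2\<^sup>2 - 60 * of_real \<alpha> * c\<^sup>2 * w2 + 35 * (of_real \<alpha>)\<^sup>2 * c ^ 4 =
     R - 48 * (1 - of_real s) * of_real s * x\<^sup>2 - 36 * ((1 - of_real s) * x)\<^sup>2
       - 60 * of_real \<alpha> * (of_real s * e) * ((1 - of_real s) * x) + 35 * (of_real \<alpha>)\<^sup>2 * (of_real s * e)\<^sup>2"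
    unfolding w2_def cc ce[symmetric] by (simp add: power_mult[symmetric])
  also have "\<dots> = R + e\<^sup>2 * Z"
    unfolding xX Z_def by (simp add: algebra_simps power2_eq_square)
  also have "cmod \<dots> \<le> cmod R + cmod Z"
    by (rule order_trans[OF norm_triangle_ineq]) (simp add: norm_mult norm_power e1)
  also have "cmod R \<le> 48 * t * (1 - s) * (1 - (cmod X)\<^sup>2)"
  proof -
    have "0 \<le> 48 * (1 - s) * (1 - (cmod X)\<^sup>2)" 
      using s1 x by (simp add: Xx abs_square_le_1)
    then have "cmod R = 48 * (1 - s) * (1 - (cmod X)\<^sup>2) * (t * cmod y)"
      unfolding R_def norm_mult norm_of_real by (simp add: t_def)
    also have "\<dots> \<le> 48 * (1 - s) * (1 - (cmod X)\<^sup>2) * (t * 1)"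
      using s1 x y t1 by (intro mult_left_mono) (auto simp: Xx abs_square_le_1)
    finally show ?thesis by (simp add: algebra_simps)
  qed
  finally have "cmod (48 * c * w3 - 36 * w2\<^sup>2 - 60 * of_real \<alpha> * c\<^sup>2 * w2 + 35 * (of_real \<alpha>)\<^sup>2 * c ^ 4)
     \<le> cmod Z + 48 * t * (1 - s) * (1 - (cmod X)\<^sup>2)" by simp
  also have "\<dots> \<le> scaled_bound \<alpha>"
    unfolding Z_def s_def using a t1 x by (intro real_parameter_estimate) (auto simp: Xx)
  finally show ?thesis .
qed

section \<open>Coefficients of Schwarz functions\<close>

text \<open>
  The Schwarz lemma in divided form; its value at \<open>0\<close> is the derivative estimate.
\<close>
lemma disc_selfmap_fixing_0_factor:
  assumes f: "f holomorphic_on unit_disc" "f 0 = 0" "\<And>z. cmod z < 1 \<Longrightarrow> cmod (f z) < 1"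
  obtains h where "h holomorphic_on unit_disc" "\<And>z. cmod z < 1 \<Longrightarrow> cmod (h z) \<le> 1"
    "\<And>z. cmod z < 1 \<Longrightarrow> f z = z * h z"
proof -
  obtain h where h: "h holomorphic_on unit_disc" "\<And>z. cmod z < 1 \<Longrightarrow> f z = z * h z"
    "deriv f 0 = h 0"
    using Schwarz3[OF f(1,2)] by metis
  have "cmod (h z) \<le> 1" if z: "cmod z < 1" for z
  proof (cases "z = 0")
    case True
    then show ?thesis using Schwarz_Lemma(2)[OF f, of 0] h(3) by simp
  next
    case False
    have "cmod z * cmod (h z) \<le> cmod z * 1"
      using Schwarz_Lemma(1)[OF f z] h(2)[OF z] by (simp add: norm_mult)
    then show ?thesis using False by simp
  qed
  then show thesis using h that by blast
qed

text \<open>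
  If \<open>f\<close> is not constant, it maps into the open disc, and the Moebius transform that sends \<open>f 0\<close>
  to \<open>0\<close> turns it into a function to which the Schwarz lemma applies.  The equation is
  \<open>f z = (f 0 + z h z) / (1 + cnj (f 0) z h z)\<close> without the division; for constant \<open>f\<close> it holds with
  \<open>h = 0\<close>, even if \<open>|f 0| = 1\<close>.
\<close>
lemma schur_step:
  assumes f: "f holomorphic_on unit_disc" "\<And>z. cmod z < 1 \<Longrightarrow> cmod (f z) \<le> 1"
  obtains h where "h holomorphic_on unit_disc" "\<And>z. cmod z < 1 \<Longrightarrow> cmod (h z) \<le> 1"
    "\<And>z. cmod z < 1 \<Longrightarrow> f z * (1 + cnj (f 0) * (z * h z)) = f 0 + z * h z"
proof (cases "f constant_on unit_disc")
  case True
  then obtain k where k: "\<And>z. z \<in> unit_disc \<Longrightarrow> f z = k"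
    unfolding constant_on_def by blast
  show thesis by (rule that[of "\<lambda>z. 0"]) (simp_all add: k)
next
  case False
  have lt: "cmod (f z) < 1" if z: "cmod z < 1" for z
  proof (rule ccontr)
    assume "\<not> cmod (f z) < 1"
    then have "cmod (f u) \<le> cmod (f z)" if "u \<in> unit_disc" for u
      using f(2)[of u] that by simp
    then have "f constant_on unit_disc"
      using z by (intro maximum_modulus_principle[OF f(1), of unit_disc z]) auto
    then show False using False by contradiction
  qed
  define c where "c = f 0"
  define g where "g z = Moebius_function 0 c (f z)" for z
  have c: "cmod c < 1" using lt[of 0] by (simp add: c_def)
  have nz: "1 - cnj c * f z \<noteq> 0" if "cmod z < 1" for z
  proof
    assume "1 - cnj c * f z = 0"
    then have "cmod (cnj c * f z) = 1" by simp
    moreover have "cmod (cnj c * f z) < 1 * 1"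
      unfolding norm_mult using c lt[OF that] by (intro mult_strict_mono') auto
    ultimately show False by simp
  qed
  have "g holomorphic_on unit_disc"
    unfolding g_def Moebius_function_simple
    by (intro holomorphic_intros f) (use nz in auto)
  moreover have "g 0 = 0" by (simp add: g_def c_def Moebius_function_eq_zero)
  moreover have "cmod (g z) < 1" if "cmod z < 1" for z
    unfolding g_def using c lt[OF that] by (rule Moebius_function_norm_lt_1)
  ultimately obtain h where h: "h holomorphic_on unit_disc"
    "\<And>z. cmod z < 1 \<Longrightarrow> cmod (h z) \<le> 1" "\<And>z. cmod z < 1 \<Longrightarrow> g z = z * h z"
    using disc_selfmap_fixing_0_factor by metis
  have "f z * (1 + cnj c * g z) = c + g z" if "cmod z < 1" for z
    using nz[OF that] by (simp add: g_def Moebius_function_simple field_simps)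
  then show thesis using h that c_def by metis
qed

lemma has_fps_expansion_unit_disc:
  assumes "f holomorphic_on unit_disc"
  shows "f has_fps_expansion fps_expansion f 0"
  by (rule has_fps_expansion_fps_expansion[OF _ _ assms]) auto

lemma fps_expansion_unique_on_ball:
  fixes f g :: "complex \<Rightarrow> complex"
  assumes "f has_fps_expansion F" "g has_fps_expansion G" "0 < r"
    "\<And>z. cmod z < r \<Longrightarrow> f z = g z"
  shows "F = G"
proof -
  have "eventually (\<lambda>z. f z = g z) (nhds 0)"
    using assms(3,4) by (auto simp: eventually_nhds_metric)
  then have "f has_fps_expansion G"
    using assms(2) has_fps_expansion_cong by blast
  then show ?thesis using assms(1) fps_expansion_unique_complex by blast
qed

lemmas fps_nth_small = fps_mult_nth sum.atLeast0_atMost_Suc numeral_2_eq_2 numeral_3_eq_3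

lemma schur_step_coefficients:
  assumes "F * (1 + fps_const (cnj c) * (fps_X * H)) = fps_const c + fps_X * H"
  shows "fps_nth F 0 = c" "fps_nth F 1 = (1 - c * cnj c) * fps_nth H 0"
    "fps_nth F 2 = (1 - c * cnj c) * (fps_nth H 1 - cnj c * (fps_nth H 0)\<^sup>2)"
proof -
  have e: "fps_nth (F * (1 + fps_const (cnj c) * (fps_X * H))) n = fps_nth (fps_const c + fps_X * H) n"
    for n using assms by simp
  show 0: "fps_nth F 0 = c" using e[of 0] by simp
  show 1: "fps_nth F 1 = (1 - c * cnj c) * fps_nth H 0"
    using e[of 1] by (simp add: fps_nth_small 0[simplified] algebra_simps)
  have 2: "fps_nth F 2 = fps_nth H 1 - cnj c * fps_nth H 0 * fps_nth F 1 - c * cnj c * fps_nth H 1"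
    using e[of 2] 0 by (simp add: fps_nth_small algebra_simps)
  show "fps_nth F 2 = (1 - c * cnj c) * (fps_nth H 1 - cnj c * (fps_nth H 0)\<^sup>2)"
    unfolding 2 1 by (simp add: algebra_simps power2_eq_square)
qed

text \<open>
  Here \<open>c\<close>, \<open>x\<close>, \<open>y\<close> are the values at \<open>0\<close> of \<open>\<omega>(z) / z\<close> and of the functions obtained from it by one
  and by two Schur steps.
\<close>
lemma schur_parameters:
  assumes w: "w holomorphic_on unit_disc" "w 0 = 0" "\<And>z. cmod z < 1 \<Longrightarrow> cmod (w z) < 1"
  obtains c x y where "cmod c \<le> 1" "cmod x \<le> 1" "cmod y \<le> 1"
    "fps_nth (fps_expansion w 0) 1 = c"
    "fps_nth (fps_expansion w 0) 2 = (1 - c * cnj c) * x"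
    "fps_nth (fps_expansion w 0) 3 = (1 - c * cnj c) * ((1 - x * cnj x) * y - cnj c * x\<^sup>2)"
proof -
  obtain f where f: "f holomorphic_on unit_disc" "\<And>z. cmod z < 1 \<Longrightarrow> cmod (f z) \<le> 1"
    "\<And>z. cmod z < 1 \<Longrightarrow> w z = z * f z"
    using disc_selfmap_fixing_0_factor[OF w] by metis
  obtain g where g: "g holomorphic_on unit_disc" "\<And>z. cmod z < 1 \<Longrightarrow> cmod (g z) \<le> 1"
    "\<And>z. cmod z < 1 \<Longrightarrow> f z * (1 + cnj (f 0) * (z * g z)) = f 0 + z * g z"
    using schur_step[OF f(1,2)] by metis
  obtain h where h: "h holomorphic_on unit_disc" "\<And>z. cmod z < 1 \<Longrightarrow> cmod (h z) \<le> 1"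
    "\<And>z. cmod z < 1 \<Longrightarrow> g z * (1 + cnj (g 0) * (z * h z)) = g 0 + z * h z"
    using schur_step[OF g(1,2)] by metis
  define W F G H where "W = fps_expansion w 0" and "F = fps_expansion f 0"
    and "G = fps_expansion g 0" and "H = fps_expansion h 0"
  note exp = has_fps_expansion_unit_disc[OF w(1), folded W_def]
    has_fps_expansion_unit_disc[OF f(1), folded F_def]
    has_fps_expansion_unit_disc[OF g(1), folded G_def]
    has_fps_expansion_unit_disc[OF h(1), folded H_def]
  have W: "W = fps_X * F"
    by (rule fps_expansion_unique_on_ball[OF exp(1), of "\<lambda>z. z * f z" _ 1])
       (use f in \<open>auto intro!: fps_expansion_intros exp\<close>)
  have F: "F * (1 + fps_const (cnj (f 0)) * (fps_X * G)) = fps_const (f 0) + fps_X * G"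
    by (rule fps_expansion_unique_on_ball[of "\<lambda>z. f z * (1 + cnj (f 0) * (z * g z))" _
          "\<lambda>z. f 0 + z * g z" _ 1])
       (use g in \<open>auto intro!: fps_expansion_intros exp\<close>)
  have G: "G * (1 + fps_const (cnj (g 0)) * (fps_X * H)) = fps_const (g 0) + fps_X * H"
    by (rule fps_expansion_unique_on_ball[of "\<lambda>z. g z * (1 + cnj (g 0) * (z * h z))" _
          "\<lambda>z. g 0 + z * h z" _ 1])
       (use h in \<open>auto intro!: fps_expansion_intros exp\<close>)
  have H: "fps_nth H 0 = h 0" by (simp add: H_def fps_expansion_def)
  have "fps_nth W 1 = fps_nth F 0" "fps_nth W 2 = fps_nth F 1" "fps_nth W 3 = fps_nth F 2"
    by (simp_all add: W numeral_3_eq_3 numeral_2_eq_2)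
  then show thesis
    using that[of "f 0" "g 0" "h 0"] f(2)[of 0] g(2)[of 0] h(2)[of 0]
      schur_step_coefficients[OF F] schur_step_coefficients[OF G] H
    by (simp add: W_def)
qed

section \<open>Power series of exponentials and inverses\<close>

text \<open>
  The recursion that the differential equation \<open>E' = E L'\<close> imposes on the coefficients.
\<close>
lemma exp_compose_coefficients:
  fixes E L :: "'a::field_char_0 fps"
  assumes E: "E = fps_exp 1 oo L" and L: "fps_nth L 0 = 0"
  shows "fps_nth E 0 = 1" "fps_nth E 1 = fps_nth L 1"
    "2 * fps_nth E 2 = fps_nth L 1 * fps_nth E 1 + 2 * fps_nth L 2"
    "3 * fps_nth E 3 = fps_nth L 1 * fps_nth E 2 + 2 * fps_nth L 2 * fps_nth E 1 + 3 * fps_nth L 3"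
proof -
  show 0: "fps_nth E 0 = 1" by (simp add: E)
  have "fps_deriv E = E * fps_deriv L"
    unfolding E using L by (simp add: fps_compose_deriv)
  then have d: "fps_nth (fps_deriv E) n = fps_nth (E * fps_deriv L) n" for n by simp
  show "fps_nth E 1 = fps_nth L 1" using d[of 0] 0 by simp
  show "2 * fps_nth E 2 = fps_nth L 1 * fps_nth E 1 + 2 * fps_nth L 2"
    using d[of 1] 0 by (simp add: fps_nth_small algebra_simps)
  show "3 * fps_nth E 3 = fps_nth L 1 * fps_nth E 2 + 2 * fps_nth L 2 * fps_nth E 1 + 3 * fps_nth L 3"
    using d[of 2] 0 by (simp add: fps_nth_small algebra_simps)
qed

text \<open>
  Factoring \<open>fps_X\<close> out of the inverse series matches the quotient in the
  logarithm and makes the powers in the composition start at the right order.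
\<close>
lemma compositional_inverse_coefficients:
  fixes F Q :: "'a::field_char_0 fps"
  assumes FG: "F oo (fps_X * Q) = fps_X" and F: "fps_nth F 0 = 0" "fps_nth F 1 = 1"
    and Q: "fps_nth Q 0 = 1"
  shows "fps_nth Q 1 = - fps_nth F 2"
    "fps_nth Q 2 = - 2 * fps_nth F 2 * fps_nth Q 1 - fps_nth F 3"
    "fps_nth Q 3 = - fps_nth F 2 * (2 * fps_nth Q 2 + (fps_nth Q 1)\<^sup>2)
       - 3 * fps_nth F 3 * fps_nth Q 1 - fps_nth F 4"
proof -
  have e: "(\<Sum>i=0..n. fps_nth F i * fps_nth (fps_X ^ i * Q ^ i) n) = fps_nth fps_X n" for n
    using arg_cong[OF FG, of "\<lambda>P. fps_nth P n"] by (simp add: fps_compose_nth power_mult_distrib)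
  note s = fps_X_power_mult_nth fps_mult_nth sum.atLeast0_atMost_Suc eval_nat_numeral
  show "fps_nth Q 1 = - fps_nth F 2"
    using e[of 2] F Q by (simp add: s eq_neg_iff_add_eq_0 algebra_simps)
  show "fps_nth Q 2 = - 2 * fps_nth F 2 * fps_nth Q 1 - fps_nth F 3"
    using e[of 3] F Q by (simp add: s eq_diff_eq eq_neg_iff_add_eq_0 algebra_simps)
  show "fps_nth Q 3 = - fps_nth F 2 * (2 * fps_nth Q 2 + (fps_nth Q 1)\<^sup>2)
       - 3 * fps_nth F 3 * fps_nth Q 1 - fps_nth F 4"
    using e[of 4] F Q by (simp add: s eq_diff_eq eq_neg_iff_add_eq_0 algebra_simps)
qed

section \<open>The Hankel determinant in terms of the Schwarz function\<close>

text \<open>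
  Near \<open>0\<close> the inverse is \<open>g w = w q w\<close> with \<open>q 0 = 1\<close>.  The coefficients of \<open>q\<close> come from
  \<open>f (g w) = w\<close>, and \<open>q\<close> is the exponential of the logarithm in question.
\<close>
lemma inverse_log_coeff_formulas:
  assumes f: "f \<in> class_A"
  defines "a \<equiv> fps_nth (fps_expansion f 0)"
  shows "inverse_log_coeff f 1 = - a 2 / 2"
    "inverse_log_coeff f 2 = - a 3 / 2 + 3 / 4 * (a 2)\<^sup>2"
    "inverse_log_coeff f 3 = - (a 4 - 4 * a 2 * a 3 + 10 / 3 * (a 2) ^ 3) / 2"
proof -
  define F where "F = fps_expansion f 0"
  have holf: "f holomorphic_on unit_disc" and f0: "f 0 = 0" and f1: "deriv f 0 = 1"
    using f by (auto simp: class_A_def)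
  have F: "f has_fps_expansion F" unfolding F_def by (rule has_fps_expansion_unit_disc[OF holf])
  have F01: "fps_nth F 0 = 0" "fps_nth F 1 = 1"
    by (simp_all add: F_def fps_expansion_def f0 f1)
  define g where "g = local_inverse f"
  have "is_local_inverse f g"
    unfolding g_def local_inverse_def using local_inverse_exists[OF f] by (rule someI_ex)
  then obtain r where r: "0 < r" "g holomorphic_on ball 0 r" "g 0 = 0"
    "\<And>w. cmod w < r \<Longrightarrow> f (g w) = w"
    unfolding is_local_inverse_def by auto
  define G where "G = fps_expansion g 0"
  have G: "g has_fps_expansion G"
    unfolding G_def by (rule has_fps_expansion_fps_expansion[OF _ _ r(2)]) (use r in auto)
  have G0: "fps_nth G 0 = 0" by (simp add: G_def fps_expansion_def r(3))
  have FG: "F oo G = fps_X"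
    by (rule fps_expansion_unique_on_ball[OF has_fps_expansion_compose[OF F G G0]
          has_fps_expansion_fps_X r(1)]) (simp add: r(4))
  have G1: "fps_nth G 1 = 1"
    using arg_cong[OF FG, of "\<lambda>P. fps_nth P 1"] F01 by (simp add: fps_compose_nth)
  define Q where "Q = fps_shift 1 G"
  have GQ: "G = fps_X * Q"
    by (rule fps_ext) (auto simp: Q_def G0 gr0_conv_Suc)
  have Q0: "fps_nth Q 0 = 1" using G1 by (simp add: Q_def)
  define q where "q w = (if w = 0 then 1 else g w / w)" for w
  have "1 \<le> subdegree G" using G0 G1 by (intro subdegree_geI) auto
  then have q: "q has_fps_expansion Q"
    using has_fps_expansion_shift[OF G, of 1 1] G1 unfolding q_def Q_def power_one_right by simp
  define l where "l = inverse_log f"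
  have l_eq: "l w = Ln (q w)" for w by (simp add: l_def inverse_log_def q_def g_def)
  have "l analytic_on {0}"
    unfolding l_eq[abs_def]
    by (intro analytic_intros has_fps_expansion_imp_analytic_0[OF q]) (auto simp: q_def)
  then have l: "l has_fps_expansion fps_expansion l 0" by (rule analytic_at_imp_has_fps_expansion_0)
  define L where "L = fps_expansion l 0"
  have L0: "fps_nth L 0 = 0" by (simp add: L_def fps_expansion_def l_eq q_def)
  have QL: "Q = fps_exp 1 oo L"
  proof (rule fps_expansion_unique_on_ball[OF q _ r(1)])
    show "(exp \<circ> l) has_fps_expansion (fps_exp 1 oo L)"
      using has_fps_expansion_compose[OF has_fps_expansion_exp1 l[folded L_def] L0] .
  next
    fix w assume "cmod w < r"
    then have "q w \<noteq> 0" using r(4)[of w] f0 by (auto simp: q_def)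
    then show "q w = (exp \<circ> l) w" by (simp add: l_eq)
  qed
  note lc = exp_compose_coefficients[OF QL L0]
  note qc = compositional_inverse_coefficients[OF FG[unfolded GQ] F01 Q0]
  have c: "inverse_log_coeff f n = fps_nth L n / 2" for n
    by (simp add: inverse_log_coeff_def L_def l_def)
  have L1: "fps_nth L 1 = - fps_nth F 2" using lc(2) qc(1) by simp
  have L2: "fps_nth L 2 = - fps_nth F 3 + 3 / 2 * (fps_nth F 2)\<^sup>2"
    using lc(2,3) qc(1,2) by (simp add: field_simps power2_eq_square)
  have Q2: "fps_nth Q 2 = 2 * (fps_nth F 2)\<^sup>2 - fps_nth F 3"
    using qc(1,2) by (simp add: power2_eq_square)
  have L3: "fps_nth L 3 = - (fps_nth F 4 - 4 * fps_nth F 2 * fps_nth F 3 + 10 / 3 * (fps_nth F 2) ^ 3)"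
  proof -
    have "3 * fps_nth L 3 = 3 * fps_nth Q 3 - fps_nth L 1 * fps_nth Q 2 - 2 * fps_nth L 2 * fps_nth Q 1"
      using lc(4) by (simp add: algebra_simps)
    also have "\<dots> = 3 * - (fps_nth F 4 - 4 * fps_nth F 2 * fps_nth F 3 + 10 / 3 * (fps_nth F 2) ^ 3)"
      unfolding qc(3) L1 L2 Q2 qc(1) by (simp add: field_simps power2_eq_square power3_eq_cube)
    finally show ?thesis unfolding mult_cancel_left by simp
  qed
  show "inverse_log_coeff f 1 = - a 2 / 2"
    "inverse_log_coeff f 2 = - a 3 / 2 + 3 / 4 * (a 2)\<^sup>2"
    "inverse_log_coeff f 3 = - (a 4 - 4 * a 2 * a 3 + 10 / 3 * (a 2) ^ 3) / 2"
    unfolding c L1 L2 L3 a_def F_def by (simp_all add: field_simps)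
qed

lemma inverse_log_hankel_eq:
  "inverse_log_hankel f = inverse_log_coeff f 1 * inverse_log_coeff f 3 - (inverse_log_coeff f 2)\<^sup>2"
  by (simp add: inverse_log_hankel_def det_2 power2_eq_square)

text \<open>
  Both \<open>z f' = f E\<close> and \<open>E = exp (\<alpha> \<omega>)\<close> are recursions for coefficients; solving them for
  \<open>a\<^sub>2, a\<^sub>3, a\<^sub>4\<close> leaves a polynomial identity.
\<close>
lemma inverse_log_hankel_starlike:
  fixes \<alpha> :: real
  assumes f: "f \<in> class_A" and w: "w holomorphic_on unit_disc" "w 0 = 0"
    and fw: "\<And>z. cmod z < 1 \<Longrightarrow> z * deriv f z = f z * exp (of_real \<alpha> * w z)"
  defines "W \<equiv> fps_nth (fps_expansion w 0)"
  shows "inverse_log_hankel f = (of_real \<alpha>)\<^sup>2 / 576 * 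
    (48 * W 1 * W 3 - 36 * (W 2)\<^sup>2 - 60 * of_real \<alpha> * (W 1)\<^sup>2 * W 2 + 35 * (of_real \<alpha>)\<^sup>2 * (W 1) ^ 4)"
proof -
  have holf: "f holomorphic_on unit_disc" and f0: "f 0 = 0" and f1: "deriv f 0 = 1"
    using f by (auto simp: class_A_def)
  define F V where "F = fps_expansion f 0" and "V = fps_const (of_real \<alpha>) * fps_expansion w 0"
  define E where "E = fps_exp 1 oo V"
  have F: "f has_fps_expansion F" unfolding F_def by (rule has_fps_expansion_unit_disc[OF holf])
  have F01: "fps_nth F 0 = 0" "fps_nth F 1 = 1"
    by (simp_all add: F_def fps_expansion_def f0 f1)
  have V: "(\<lambda>z. of_real \<alpha> * w z) has_fps_expansion V"
    unfolding V_def by (intro fps_expansion_intros has_fps_expansion_unit_disc[OF w(1)])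
  have V0: "fps_nth V 0 = 0" by (simp add: V_def fps_expansion_def w)
  have E: "(\<lambda>z. exp (of_real \<alpha> * w z)) has_fps_expansion E"
    using has_fps_expansion_compose[OF has_fps_expansion_exp1 V V0] by (simp add: E_def o_def)
  have "fps_X * fps_deriv F = F * E"
    by (rule fps_expansion_unique_on_ball[of "\<lambda>z. z * deriv f z" _ "\<lambda>z. f z * exp (of_real \<alpha> * w z)" _ 1])
       (auto intro!: has_fps_expansion_mult has_fps_expansion_fps_X has_fps_expansion_deriv F E fw)
  then have d: "fps_nth (fps_X * fps_deriv F) n = fps_nth (F * E) n" for n by simp
  note ec = exp_compose_coefficients[OF E_def V0]
  have VW: "fps_nth V n = \<alpha> * W n" for n by (simp add: V_def W_def)
  have E1: "fps_nth E 1 = \<alpha> * W 1" using ec(2) VW by simp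
  have E2: "fps_nth E 2 = \<alpha> * W 2 + \<alpha>\<^sup>2 * (W 1)\<^sup>2 / 2"
    using ec(3) unfolding E1 VW by (simp add: field_simps power2_eq_square)
  have E3: "fps_nth E 3 = \<alpha> * W 3 + \<alpha>\<^sup>2 * W 1 * W 2 + \<alpha> ^ 3 * (W 1) ^ 3 / 6"
    using ec(4) unfolding E1 E2 VW by (simp add: field_simps power2_eq_square power3_eq_cube)
  have F2: "fps_nth F 2 = fps_nth E 1"
    using d[of 2] F01 ec(1) by (simp add: fps_nth_small algebra_simps)
  have F3: "2 * fps_nth F 3 = fps_nth F 2 * fps_nth E 1 + fps_nth E 2"
    using d[of 3] F01 ec(1) by (simp add: fps_nth_small algebra_simps)
  have F4: "3 * fps_nth F 4 = fps_nth F 3 * fps_nth E 1 + fps_nth F 2 * fps_nth E 2 + fps_nth E 3"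
    using d[of 4] F01 ec(1) by (simp add: fps_mult_nth sum.atLeast0_atMost_Suc eval_nat_numeral algebra_simps)
  have F3': "fps_nth F 3 = ((\<alpha> * W 1)\<^sup>2 + fps_nth E 2) / 2"
    using F3 unfolding F2 E1 by (simp add: field_simps power2_eq_square)
  have F4': "fps_nth F 4 = (fps_nth F 3 * (\<alpha> * W 1) + \<alpha> * W 1 * fps_nth E 2 + fps_nth E 3) / 3"
    using F4 unfolding F2 E1 by (simp add: field_simps)
  note G = inverse_log_coeff_formulas[OF f, folded F_def]
  show ?thesis
    unfolding inverse_log_hankel_eq G F4' F3' F2 E1 E2 E3
    by (simp add: field_simps power2_eq_square power3_eq_cube power4_eq_xxxx)
qed

section \<open>The class of starlike functions\<close>

text \<open>
  The function is \<open>f z = z exp (k z)\<close>, where \<open>k\<close> is the primitive of \<open>(exp (\<alpha> \<omega>(z)) - 1) / z\<close> that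
  vanishes at \<open>0\<close>.
\<close>
lemma starlike_exp_exists:
  fixes \<alpha> :: real
  assumes w: "w holomorphic_on unit_disc" "w ` unit_disc \<subseteq> unit_disc" "w 0 = 0"
  obtains f where "f \<in> starlike_exp \<alpha>" 
    "\<And>z. cmod z < 1 \<Longrightarrow> z * deriv f z = f z * exp (of_real \<alpha> * w z)"
proof -
  have e: "(\<lambda>z. exp (of_real \<alpha> * w z) - 1) holomorphic_on unit_disc"
    by (intro holomorphic_intros w)
  obtain h where h: "h holomorphic_on unit_disc"
    "\<And>z. cmod z < 1 \<Longrightarrow> exp (of_real \<alpha> * w z) - 1 = z * h z"
    using Schwarz3[OF e] w(3) by auto
  obtain k0 where k0: "\<And>z. z \<in> unit_disc \<Longrightarrow> (k0 has_field_derivative h z) (at z within unit_disc)"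
    using holomorphic_convex_primitive'[OF convex_ball open_ball h(1)] by metis
  have k0: "(k0 has_field_derivative h z) (at z)" if "cmod z < 1" for z
    using k0[of z] that by (simp add: at_within_open[OF _ open_ball])
  define f where "f z = z * exp (k0 z - k0 0)" for z
  have df: "(f has_field_derivative exp (k0 z - k0 0) * (1 + z * h z)) (at z)" if "cmod z < 1" for z
    unfolding f_def by (rule derivative_eq_intros k0[OF that] refl)+ (simp add: algebra_simps)
  have deriv_f: "deriv f z = exp (k0 z - k0 0) * exp (of_real \<alpha> * w z)" if "cmod z < 1" for z
    using DERIV_imp_deriv[OF df[OF that]] h(2)[OF that] by (simp add: algebra_simps flip: h(2))
  have holf: "f holomorphic_on unit_disc"
    using df by (intro holomorphic_onI) (auto simp: field_differentiable_def intro: has_field_derivative_at_within)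
  have fA: "f \<in> class_A"
    using holf deriv_f[of 0] w(3) by (simp add: class_A_def f_def)
  have eq: "(if z = 0 then 1 else z * deriv f z / f z) = exp (of_real \<alpha> * w z)" if "cmod z < 1" for z
    using deriv_f[OF that] w(3) by (simp add: f_def)
  have "(\<lambda>z. if z = 0 then 1 else z * deriv f z / f z) holomorphic_on unit_disc"
    by (rule holomorphic_transform[of "\<lambda>z. exp (of_real \<alpha> * w z)"])
       (auto simp: eq intro!: holomorphic_intros w(1))
  then have "subordinate (\<lambda>z. if z = 0 then 1 else z * deriv f z / f z) (\<lambda>z. exp (of_real \<alpha> * z))"
    unfolding subordinate_def using w eq by (auto intro!: holomorphic_intros exI[of _ w])
  then have "f \<in> starlike_exp \<alpha>" using fA by (simp add: starlike_exp_def)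
  moreover have "z * deriv f z = f z * exp (of_real \<alpha> * w z)" if "cmod z < 1" for z
    using deriv_f[OF that] by (simp add: f_def)
  ultimately show thesis using that by blast
qed

lemma starlike_exp_schwarz_function:
  assumes "f \<in> starlike_exp \<alpha>"
  obtains w where "w holomorphic_on unit_disc" "w 0 = 0" "\<And>z. cmod z < 1 \<Longrightarrow> cmod (w z) < 1"
    "\<And>z. cmod z < 1 \<Longrightarrow> z * deriv f z = f z * exp (of_real \<alpha> * w z)"
proof -
  obtain w where w: "w holomorphic_on unit_disc" "w ` unit_disc \<subseteq> unit_disc" "w 0 = 0"
    "\<And>z. z \<in> unit_disc \<Longrightarrow> (if z = 0 then 1 else z * deriv f z / f z) = exp (of_real \<alpha> * w z)"
    using assms unfolding starlike_exp_def subordinate_def by auto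
  have f0: "f 0 = 0" using assms by (simp add: starlike_exp_def class_A_def)
  have "z * deriv f z = f z * exp (of_real \<alpha> * w z)" if "cmod z < 1" for z
  proof (cases "z = 0")
    case False
    then have eq: "z * deriv f z / f z = exp (of_real \<alpha> * w z)" using w(4)[of z] that by simp
    then have "f z \<noteq> 0" by (metis div_by_0 exp_not_eq_zero)
    then show ?thesis using eq by (simp add: field_simps)
  qed (simp add: f0)
  moreover have "cmod (w z) < 1" if "cmod z < 1" for z using w(2) that by force
  ultimately show thesis using w that by blast
qed

text \<open>
  The extremal Schwarz function: it has Schur parameters \<open>c\<close> and \<open>x = 1\<close>, where
  the estimate \<open>cmod_quadratic_le_linear_case\<close> is an equality.
\<close>
lemma blaschke_coefficients:
  fixes c :: real
  assumes c: "0 \<le> c" "c < 1"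
  defines "w \<equiv> \<lambda>z. z * ((z + of_real c) / (1 + of_real c * z))"
  shows "w holomorphic_on unit_disc" "w 0 = 0" "w ` unit_disc \<subseteq> unit_disc"
    "fps_nth (fps_expansion w 0) 1 = of_real c"
    "fps_nth (fps_expansion w 0) 2 = 1 - (of_real c)\<^sup>2"
    "fps_nth (fps_expansion w 0) 3 = - of_real c * (1 - (of_real c)\<^sup>2)"
proof -
  have nz: "1 + of_real c * z \<noteq> 0" if "cmod z < 1" for z
  proof
    assume "1 + of_real c * z = 0"
    then have "of_real c * z = -1" by (simp add: add_eq_0_iff)
    then have "cmod (of_real c * z) = 1" by simp
    moreover have "cmod (of_real c * z) < 1 * 1"
      unfolding norm_mult using c that by (intro mult_strict_mono') auto
    ultimately show False by simp
  qed
  show hol: "w holomorphic_on unit_disc"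
    unfolding w_def by (intro holomorphic_intros) (use nz in auto)
  show w0: "w 0 = 0" by (simp add: w_def)
  show "w ` unit_disc \<subseteq> unit_disc"
  proof clarsimp
    fix z :: complex assume z: "cmod z < 1"
    have "cmod ((z + of_real c) / (1 + of_real c * z)) < 1"
      using Moebius_function_norm_lt_1[of "- of_real c" z 0] c z
      by (simp add: Moebius_function_simple)
    then have "cmod z * cmod ((z + of_real c) / (1 + of_real c * z)) < 1 * 1"
      using z by (intro mult_strict_mono') auto
    then show "cmod (w z) < 1" unfolding w_def norm_mult[of z] by simp
  qed
  define W where "W = fps_expansion w 0"
  have W: "w has_fps_expansion W" unfolding W_def by (rule has_fps_expansion_unit_disc[OF hol])
  have "W * (1 + fps_const (of_real c) * fps_X) = fps_X * (fps_X + fps_const (of_real c))"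
  proof (rule fps_expansion_unique_on_ball)
    show "(\<lambda>z. w z * (1 + of_real c * z)) has_fps_expansion
        W * (1 + fps_const (of_real c) * fps_X)"
      by (intro fps_expansion_intros W)
    show "(\<lambda>z::complex. z * (z + of_real c)) has_fps_expansion fps_X * (fps_X + fps_const (of_real c))"
      by (intro fps_expansion_intros)
    show "w z * (1 + of_real c * z) = z * (z + of_real c)" if "cmod z < 1" for z
      using nz[OF that] by (simp add: w_def)
  qed simp
  then have d: "fps_nth (W * (1 + fps_const (of_real c) * fps_X)) n
    = fps_nth (fps_X * (fps_X + fps_const (of_real c))) n" for n by simp
  have W0: "fps_nth W 0 = 0" using d[of 0] by simp
  have W1: "fps_nth W 1 = of_real c" using d[of 1] W0 by (simp add: fps_nth_small)
  have W2: "fps_nth W 2 = 1 - (of_real c)\<^sup>2" using d[of 2] W0 W1 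
    by (simp add: fps_nth_small power2_eq_square algebra_simps)
  have W3: "fps_nth W 3 = - of_real c * (1 - (of_real c)\<^sup>2)" 
  proof -
    have "fps_nth W 3 + fps_nth W 2 * of_real c = 0" using d[of 3] W0 by (simp add: fps_nth_small add_ac)
    then show ?thesis unfolding W2 by (simp add: add_eq_0_iff algebra_simps)
  qed
  show "fps_nth (fps_expansion w 0) 1 = of_real c"
    "fps_nth (fps_expansion w 0) 2 = 1 - (of_real c)\<^sup>2"
    "fps_nth (fps_expansion w 0) 3 = - of_real c * (1 - (of_real c)\<^sup>2)"
    using W1 W2 W3 by (simp_all add: W_def)
qed

section \<open>The sharp bound\<close>

theorem theorem5p1:
  fixes \<alpha> :: real
  assumes "0 < \<alpha>" and "\<alpha> \<le> 1"
  shows "let bound = (if \<alpha> \<le> 2 / 5 then \<alpha>^2 / 16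
                      else \<alpha>^2 * (15 * \<alpha>^2 + 10 * \<alpha> + 4) / (4 * (35 * \<alpha>^2 + 60 * \<alpha> + 12)))
         in (\<forall>f \<in> starlike_exp \<alpha>. cmod (inverse_log_hankel f) \<le> bound) \<and>
            (\<exists>f \<in> starlike_exp \<alpha>. cmod (inverse_log_hankel f) = bound)"
proof -
  define d where "d = 12 + 60 * \<alpha> + 35 * \<alpha>\<^sup>2"
  have d: "0 < d" using assms unfolding d_def by (intro add_pos_nonneg) auto
  define bound where "bound = (if \<alpha> \<le> 2 / 5 then \<alpha>^2 / 16
                      else \<alpha>^2 * (15 * \<alpha>^2 + 10 * \<alpha> + 4) / (4 * (35 * \<alpha>^2 + 60 * \<alpha> + 12)))"
  have bound: "bound = \<alpha>\<^sup>2 / 576 * scaled_bound \<alpha>"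
  proof (cases "\<alpha> \<le> 2/5")
    case False
    have "36 + (30 * \<alpha> - 12)\<^sup>2 / d = 144 * (15 * \<alpha>^2 + 10 * \<alpha> + 4) / d"
      using d by (simp add: field_simps) (simp add: d_def power2_eq_square algebra_simps)
    moreover have "35 * \<alpha>\<^sup>2 + 60 * \<alpha> + 12 = d" by (simp add: d_def)
    ultimately show ?thesis using False
      unfolding bound_def scaled_bound_def d_def[symmetric]
      using d by (simp add: field_simps)
  qed (simp add: bound_def scaled_bound_def)
  have upper: "cmod (inverse_log_hankel f) \<le> bound" if f: "f \<in> starlike_exp \<alpha>" for f
  proof -
    obtain w where w: "w holomorphic_on unit_disc" "w 0 = 0" "\<And>z. cmod z < 1 \<Longrightarrow> cmod (w z) < 1"
      "\<And>z. cmod z < 1 \<Longrightarrow> z * deriv f z = f z * exp (of_real \<alpha> * w z)"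
      using starlike_exp_schwarz_function[OF f] by metis
    obtain c x y where cxy: "cmod c \<le> 1" "cmod x \<le> 1" "cmod y \<le> 1"
      "fps_nth (fps_expansion w 0) 1 = c"
      "fps_nth (fps_expansion w 0) 2 = (1 - c * cnj c) * x"
      "fps_nth (fps_expansion w 0) 3 = (1 - c * cnj c) * ((1 - x * cnj x) * y - cnj c * x\<^sup>2)"
      using schur_parameters[OF w(1-3)] by metis
    have fA: "f \<in> class_A" using f by (simp add: starlike_exp_def)
    define P where "P = 48 * c * ((1 - c * cnj c) * ((1 - x * cnj x) * y - cnj c * x\<^sup>2))
      - 36 * ((1 - c * cnj c) * x)\<^sup>2 - 60 * of_real \<alpha> * c\<^sup>2 * ((1 - c * cnj c) * x)
      + 35 * (of_real \<alpha>)\<^sup>2 * c ^ 4"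
    have "inverse_log_hankel f = (of_real \<alpha>)\<^sup>2 / 576 * P"
      unfolding P_def
      by (rule inverse_log_hankel_starlike[OF fA w(1,2), unfolded cxy(4-6)]) (rule w(4))
    then have "cmod (inverse_log_hankel f) = \<alpha>\<^sup>2 / 576 * cmod P"
      by (simp only: norm_mult norm_power norm_divide norm_of_real) simp
    also have "\<dots> \<le> \<alpha>\<^sup>2 / 576 * scaled_bound \<alpha>"
      unfolding P_def
      by (rule mult_left_mono[OF schur_parameter_estimate[OF assms cxy(1-3)]]) simp
    finally show ?thesis unfolding bound .
  qed
  \<comment> \<open>the vertex of the parabola in \<open>parabola_le_scaled_bound\<close>, cut off at \<open>0\<close> for \<open>\<alpha> \<le> 2/5\<close>\<close>
  define s where "s = max 0 ((30 * \<alpha> - 12) / d)"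
  have s: "0 \<le> s" "s < 1"
    using assms d by (auto simp: s_def pos_divide_less_eq) (simp add: d_def add_pos_nonneg)
  have peak: "36 + (60 * \<alpha> - 24) * s - d * s\<^sup>2 = scaled_bound \<alpha>"
  proof (cases "\<alpha> \<le> 2/5")
    case True
    then have "(30 * \<alpha> - 12) / d \<le> 0" using d by (intro divide_nonpos_pos) auto
    then have "s = 0" unfolding s_def by (rule max_absorb1)
    then show ?thesis using True by (simp add: scaled_bound_def)
  next
    case False
    then have sd: "s = (30 * \<alpha> - 12) / d" using d by (simp add: s_def)
    then have "d * s = 30 * \<alpha> - 12" using d by simp
    moreover have "36 + (60 * \<alpha> - 24) * s - d * s\<^sup>2 = 36 + (2 * (30 * \<alpha> - 12) - d * s) * s"
      by (simp add: power2_eq_square algebra_simps)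
    ultimately have "36 + (60 * \<alpha> - 24) * s - d * s\<^sup>2 = 36 + (30 * \<alpha> - 12) * s"
      by simp
    then show ?thesis using False sd by (simp add: scaled_bound_def d_def power2_eq_square)
  qed
  define c where "c = sqrt s"
  have c: "0 \<le> c" "c < 1" "c\<^sup>2 = s" using s by (auto simp: c_def)
  note b = blaschke_coefficients[OF c(1,2)]
  obtain f where f: "f \<in> starlike_exp \<alpha>" 
    "\<And>z. cmod z < 1 \<Longrightarrow> z * deriv f z = f z * exp (of_real \<alpha> * (z * ((z + of_real c) / (1 + of_real c * z))))"
    using starlike_exp_exists[OF b(1,3,2)] by metis
  have fA: "f \<in> class_A" using f by (simp add: starlike_exp_def)
  have real_eq: "48 * c * (- c * (1 - c\<^sup>2)) - 36 * (1 - c\<^sup>2)\<^sup>2 - 60 * \<alpha> * c\<^sup>2 * (1 - c\<^sup>2)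
      + 35 * \<alpha>\<^sup>2 * c ^ 4 = - scaled_bound \<alpha>"
    unfolding peak[symmetric] c(3)[symmetric] d_def
    by (simp add: algebra_simps power2_eq_square power4_eq_xxxx)
  let ?c = "complex_of_real c"
  have "inverse_log_hankel f = (of_real \<alpha>)\<^sup>2 / 576 * (48 * ?c * (- ?c * (1 - ?c\<^sup>2))
      - 36 * (1 - ?c\<^sup>2)\<^sup>2 - 60 * of_real \<alpha> * ?c\<^sup>2 * (1 - ?c\<^sup>2) + 35 * (of_real \<alpha>)\<^sup>2 * ?c ^ 4)"
    by (rule inverse_log_hankel_starlike[OF fA b(1,2), unfolded b(4-6)]) (rule f(2))
  also have "\<dots> = of_real (\<alpha>\<^sup>2 / 576 * (48 * c * (- c * (1 - c\<^sup>2)) - 36 * (1 - c\<^sup>2)\<^sup>2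
      - 60 * \<alpha> * c\<^sup>2 * (1 - c\<^sup>2) + 35 * \<alpha>\<^sup>2 * c ^ 4))"
    by simp
  also have "\<dots> = of_real (\<alpha>\<^sup>2 / 576 * (- scaled_bound \<alpha>))"
    unfolding real_eq ..
  finally have "cmod (inverse_log_hankel f) = \<bar>\<alpha>\<^sup>2 / 576 * (- scaled_bound \<alpha>)\<bar>"
    by (simp only: norm_of_real)
  also have "\<dots> = bound"
    using scaled_bound_ge[OF assms(1)] unfolding bound abs_mult by simp
  finally have "cmod (inverse_log_hankel f) = bound" .
  then show ?thesis
    unfolding Let_def bound_def[symmetric] using upper f(1) by (intro conjI ballI bexI[of _ f])
qed

end
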